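(* Let $G$ be a countable structure, let $\mathcal F$ be a cofinal subclass of $\mathrm{Age}(G)$ (closed under isomorphisms), and assume Eve does not have a winning strategy in the game $\mathrm{BM}(\mathcal F, G)$. Then $\mathcal F$ is a weak Fraïssé class.
   Context: Fix a countable first-order signature. $X \leq Y$ means that $X$ is a substructure of $Y$. $\mathrm{Age}(G)$ is the class of all finitely generated structures embeddable into $G$. A subclass $\mathcal F$ of $\mathrm{Age}(G)$ is cofinal if every $X \in \mathrm{Age}(G)$ is a substructure of some $Y \in \mathcal F$. The game $\mathrm{BM}(\mathcal F, G)$: two players, Eve and Odd, alternately build a chain $A_0 \leq A_1 \leq A_2 \leq \cdots$ of structures from $\mathcal F$. Eve starts by choosing $A_0 \in \mathcal F$; Odd responds with $A_1 \in \mathcal F$, $A_1 \geq A_0$; Eve responds with $A_2 \in \mathcal F$, $A_2 \geq A_1$; and so on (Eve chooses $A_n$ for even $n$, Odd for odd $n$). Odd wins if $A_\infty = \bigcup_{n\in\omega} A_n$ is isomorphic to $G$; otherwise Eve wins. A strategy prescribes a player's move as a function of the finite sequence of previous moves; it is winning if the player wins every play in which it is followed. $\mathcal F$ has the joint embedding property (JEP) if for all $X, Y \in \mathcal F$ there is $Z \in \mathcal F$ such that both $X$ and $Y$ embed into $Z$. $\mathcal F$ has the weak amalgamation property (WAP) if for every $Z \in \mathcal F$ there is $Z' \in \mathcal F$ with $Z \leq Z'$ such that for all embeddings $f\colon Z' \to X$, $g\colon Z' \to Y$ with $X, Y \in \mathcal F$ there exist $V \in \mathcal F$ and embeddings $f'\colon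 X \to V$, $g'\colon Y \to V$ satisfying $f'\circ f \restriction Z = g' \circ g\restriction Z$. $\mathcal F$ is a weak Fraïssé class if it has the JEP, the WAP, and contains only countably many isomorphism types. *)

theory Defs
  imports Main "HOL-Library.Countable_Set"
begin

record ('f, 'r) signature =
  funcs :: "'f set"
  rels :: "'r set"
  farity :: "'f \<Rightarrow> nat"
  rarity :: "'r \<Rightarrow> nat"

text \<open>
  Constants are function symbols of arity 0. Sets of symbols are used instead of whole types, so
  that a signature may have no function symbols or no relation symbols.
\<close>

definition countable_signature :: "('f, 'r) signature \<Rightarrow> bool" where
  "countable_signature S \<longleftrightarrow> countable (funcs S) \<and> countable (rels S)"

text \<open>
  Only the values of \<open>fint\<close> and \<open>rint\<close> at symbols of the signature and at tuples over
  the carrier of the right length are meaningful; no notion below depends on the other values.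
  An empty carrier is allowed (it can occur only if there are no constants).
\<close>

record ('a, 'f, 'r) struct =
  carrier :: "'a set"
  fint :: "'f \<Rightarrow> 'a list \<Rightarrow> 'a"
  rint :: "'r \<Rightarrow> 'a list \<Rightarrow> bool"

definition tuples :: "'a set \<Rightarrow> nat \<Rightarrow> 'a list set" where
  "tuples A n = {xs. set xs \<subseteq> A \<and> length xs = n}"

definition is_struct :: "('f, 'r) signature \<Rightarrow> ('a, 'f, 'r) struct \<Rightarrow> bool" where
  "is_struct S X \<longleftrightarrow>
     (\<forall>f\<in>funcs S. \<forall>xs\<in>tuples (carrier X) (farity S f). fint X f xs \<in> carrier X)"

definition substruct ::
  "('f, 'r) signature \<Rightarrow> ('a, 'f, 'r) struct \<Rightarrow> ('a, 'f, 'r) struct \<Rightarrow> bool" where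
  "substruct S X Y \<longleftrightarrow>
     is_struct S X \<and> is_struct S Y \<and> carrier X \<subseteq> carrier Y \<and>
     (\<forall>f\<in>funcs S. \<forall>xs\<in>tuples (carrier X) (farity S f). fint X f xs = fint Y f xs) \<and>
     (\<forall>r\<in>rels S. \<forall>xs\<in>tuples (carrier X) (rarity S r). rint X r xs \<longleftrightarrow> rint Y r xs)"

definition embedding ::
  "('f, 'r) signature \<Rightarrow> ('a, 'f, 'r) struct \<Rightarrow> ('b, 'f, 'r) struct \<Rightarrow> ('a \<Rightarrow> 'b) \<Rightarrow> bool"
where
  "embedding S X Y h \<longleftrightarrow>
     is_struct S X \<and> is_struct S Y \<and> h ` carrier X \<subseteq> carrier Y \<and> inj_on h (carrier X) \<and>
     (\<forall>f\<in>funcs S. \<forall>xs\<in>tuples (carrier X) (farity S f).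
        h (fint X f xs) = fint Y f (map h xs)) \<and>
     (\<forall>r\<in>rels S. \<forall>xs\<in>tuples (carrier X) (rarity S r).
        rint X r xs \<longleftrightarrow> rint Y r (map h xs))"

definition embeds ::
  "('f, 'r) signature \<Rightarrow> ('a, 'f, 'r) struct \<Rightarrow> ('b, 'f, 'r) struct \<Rightarrow> bool" where
  "embeds S X Y \<longleftrightarrow> (\<exists>h. embedding S X Y h)"

definition isomorphic ::
  "('f, 'r) signature \<Rightarrow> ('a, 'f, 'r) struct \<Rightarrow> ('b, 'f, 'r) struct \<Rightarrow> bool" where
  "isomorphic S X Y \<longleftrightarrow> (\<exists>h. embedding S X Y h \<and> h ` carrier X = carrier Y)"

inductive_set generated :: "('f, 'r) signature \<Rightarrow> ('a, 'f, 'r) struct \<Rightarrow> 'a set \<Rightarrow> 'a set"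
  for S X B where
  base: "x \<in> B \<Longrightarrow> x \<in> generated S X B"
| app: "f \<in> funcs S \<Longrightarrow> length xs = farity S f \<Longrightarrow> (\<And>x. x \<in> set xs \<Longrightarrow> x \<in> generated S X B)
        \<Longrightarrow> fint X f xs \<in> generated S X B"

definition finitely_generated :: "('f, 'r) signature \<Rightarrow> ('a, 'f, 'r) struct \<Rightarrow> bool" where
  "finitely_generated S X \<longleftrightarrow>
     is_struct S X \<and> (\<exists>B. finite B \<and> B \<subseteq> carrier X \<and> generated S X B = carrier X)"

text \<open>
  Classes of structures are sets of structures whose elements are taken from one universe, the
  type \<open>'a\<close>. When \<open>'a\<close> is uncountable, every countable structure has a copy in it, and every
  embedding of countable structures can be turned into an inclusion by moving the larger one to
  a copy.
\<close>

definition Age :: "('f, 'r) signature \<Rightarrow> ('a, 'f, 'r) struct \<Rightarrow> ('a, 'f, 'r) struct set" where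
  "Age S G = {X. finitely_generated S X \<and> embeds S X G}"

definition cofinal_in ::
  "('f, 'r) signature \<Rightarrow> ('a, 'f, 'r) struct set \<Rightarrow> ('a, 'f, 'r) struct set \<Rightarrow> bool" where
  "cofinal_in S F K \<longleftrightarrow> F \<subseteq> K \<and> (\<forall>X\<in>K. \<exists>Y\<in>F. substruct S X Y)"

definition iso_closed :: "('f, 'r) signature \<Rightarrow> ('a, 'f, 'r) struct set \<Rightarrow> bool" where
  "iso_closed S F \<longleftrightarrow> (\<forall>X\<in>F. \<forall>Y. isomorphic S X Y \<longrightarrow> Y \<in> F)"

text \<open>
  For a chain \<open>A\<close> of structures, the interpretation of a function symbol at a tuple of the union
  does not depend on the member of the chain used to evaluate it; the first suitable one is taken.
\<close>

definition chain_union :: "(nat \<Rightarrow> ('a, 'f, 'r) struct) \<Rightarrow> ('a, 'f, 'r) struct" where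
  "chain_union A =
     \<lparr>carrier = (\<Union>n. carrier (A n)),
      fint = (\<lambda>f xs. fint (A (LEAST n. set xs \<subseteq> carrier (A n))) f xs),
      rint = (\<lambda>r xs. \<exists>n. set xs \<subseteq> carrier (A n) \<and> rint (A n) r xs)\<rparr>"

definition position ::
  "('f, 'r) signature \<Rightarrow> ('a, 'f, 'r) struct set \<Rightarrow> ('a, 'f, 'r) struct list \<Rightarrow> bool" where
  "position S F s \<longleftrightarrow> set s \<subseteq> F \<and> successively (substruct S) s"

definition BM_play ::
  "('f, 'r) signature \<Rightarrow> ('a, 'f, 'r) struct set \<Rightarrow> (nat \<Rightarrow> ('a, 'f, 'r) struct) \<Rightarrow> bool" where
  "BM_play S F A \<longleftrightarrow> (\<forall>n. A n \<in> F \<and> substruct S (A n) (A (Suc n)))"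

definition odd_wins ::
  "('f, 'r) signature \<Rightarrow> ('a, 'f, 'r) struct \<Rightarrow> (nat \<Rightarrow> ('a, 'f, 'r) struct) \<Rightarrow> bool" where
  "odd_wins S G A \<longleftrightarrow> isomorphic S (chain_union A) G"

text \<open>
  A strategy of Eve has to return a legal move at every position in which she is to move, that is,
  at every position of even length.
\<close>

definition eve_strategy ::
  "('f, 'r) signature \<Rightarrow> ('a, 'f, 'r) struct set \<Rightarrow>
   (('a, 'f, 'r) struct list \<Rightarrow> ('a, 'f, 'r) struct) \<Rightarrow> bool" where
  "eve_strategy S F \<sigma> \<longleftrightarrow>
     (\<forall>s. position S F s \<and> even (length s) \<longrightarrow> position S F (s @ [\<sigma> s]))"

definition eve_follows ::
  "(('a, 'f, 'r) struct list \<Rightarrow> ('a, 'f, 'r) struct) \<Rightarrow>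
   (nat \<Rightarrow> ('a, 'f, 'r) struct) \<Rightarrow> bool" where
  "eve_follows \<sigma> A \<longleftrightarrow> (\<forall>n. even n \<longrightarrow> A n = \<sigma> (map A [0..<n]))"

definition eve_winning_strategy ::
  "('f, 'r) signature \<Rightarrow> ('a, 'f, 'r) struct set \<Rightarrow> ('a, 'f, 'r) struct \<Rightarrow>
   (('a, 'f, 'r) struct list \<Rightarrow> ('a, 'f, 'r) struct) \<Rightarrow> bool" where
  "eve_winning_strategy S F G \<sigma> \<longleftrightarrow>
     eve_strategy S F \<sigma> \<and> (\<forall>A. BM_play S F A \<and> eve_follows \<sigma> A \<longrightarrow> \<not> odd_wins S G A)"

definition JEP :: "('f, 'r) signature \<Rightarrow> ('a, 'f, 'r) struct set \<Rightarrow> bool" where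
  "JEP S F \<longleftrightarrow> (\<forall>X\<in>F. \<forall>Y\<in>F. \<exists>Z\<in>F. embeds S X Z \<and> embeds S Y Z)"

definition WAP :: "('f, 'r) signature \<Rightarrow> ('a, 'f, 'r) struct set \<Rightarrow> bool" where
  "WAP S F \<longleftrightarrow>
     (\<forall>Z\<in>F. \<exists>Z'\<in>F. substruct S Z Z' \<and>
        (\<forall>X\<in>F. \<forall>Y\<in>F. \<forall>f g. embedding S Z' X f \<and> embedding S Z' Y g \<longrightarrow>
           (\<exists>V\<in>F. \<exists>f' g'. embedding S X V f' \<and> embedding S Y V g' \<and>
              (\<forall>z\<in>carrier Z. f' (f z) = g' (g z)))))"

definition iso_types ::
  "('f, 'r) signature \<Rightarrow> ('a, 'f, 'r) struct set \<Rightarrow> ('a, 'f, 'r) struct set set" where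
  "iso_types S F = F // {(X, Y). X \<in> F \<and> Y \<in> F \<and> isomorphic S X Y}"

definition weak_Fraisse_class :: "('f, 'r) signature \<Rightarrow> ('a, 'f, 'r) struct set \<Rightarrow> bool" where
  "weak_Fraisse_class S F \<longleftrightarrow> JEP S F \<and> WAP S F \<and> countable (iso_types S F)"

end

(* Joint embeddings and the countability of the set of isomorphism types come from generating
   inside G. If WAP fails at Z, then every A \<ge> Z in F has two extensions X, Y that cannot be
   amalgamated over Z. For a fixed embedding e of Z into G, at most one of X and Y embeds
   into G over e, since two such embeddings would give an amalgam inside G. As Z is finitely
   generated and G is countable, there are only countably many e, so Eve can start with Z and
   exclude one e at each of her later moves; the union of the chain is then not isomorphic to G. *)
theory Submission
  imports Defs
begin

section \<open>Embeddings and copies\<close>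

lemma embedding_structs:
  assumes "embedding S X Y h"
  shows "is_struct S X" "is_struct S Y"
  using assms by (auto simp: embedding_def)

lemma embedding_mem: "embedding S X Y h \<Longrightarrow> x \<in> carrier X \<Longrightarrow> h x \<in> carrier Y"
  by (auto simp: embedding_def)

lemma embedding_inj: "embedding S X Y h \<Longrightarrow> inj_on h (carrier X)"
  by (simp add: embedding_def)

lemma embedding_fint:
  assumes "embedding S X Y h" "f \<in> funcs S" "xs \<in> tuples (carrier X) (farity S f)"
  shows "h (fint X f xs) = fint Y f (map h xs)"
  using assms by (simp add: embedding_def)

lemma embedding_rint:
  assumes "embedding S X Y h" "r \<in> rels S" "xs \<in> tuples (carrier X) (rarity S r)"
  shows "rint Y r (map h xs) \<longleftrightarrow> rint X r xs"
  using assms by (simp add: embedding_def)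

lemma map_tuples: "h ` A \<subseteq> B \<Longrightarrow> xs \<in> tuples A n \<Longrightarrow> map h xs \<in> tuples B n"
  by (auto simp: tuples_def)

lemma embedding_compose:
  assumes f: "embedding S X Y f" and g: "embedding S Y Z g"
  shows "embedding S X Z (g \<circ> f)"
proof -
  have im: "f ` carrier X \<subseteq> carrier Y" using f by (simp add: embedding_def)
  have inj: "inj_on (g \<circ> f) (carrier X)"
    using f g im by (meson comp_inj_on embedding_inj inj_on_subset)
  have "(g \<circ> f) ` carrier X \<subseteq> carrier Z"
    using im embedding_mem[OF g] by fastforce
  moreover have "(g \<circ> f) (fint X s xs) = fint Z s (map (g \<circ> f) xs)"
    if "s \<in> funcs S" "xs \<in> tuples (carrier X) (farity S s)" for s xs
    using embedding_fint[OF f that] embedding_fint[OF g that(1) map_tuples[OF im that(2)]] by simp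
  moreover have "rint X s xs \<longleftrightarrow> rint Z s (map (g \<circ> f) xs)"
    if "s \<in> rels S" "xs \<in> tuples (carrier X) (rarity S s)" for s xs
    using embedding_rint[OF f that] embedding_rint[OF g that(1) map_tuples[OF im that(2)]] by simp
  ultimately show ?thesis
    using embedding_structs[OF f] embedding_structs[OF g] inj unfolding embedding_def by blast
qed

text \<open>Inclusions become a special case of embeddings, so facts about substructures follow from
  composition of embeddings.\<close>

lemma embedding_id_iff_substruct: "embedding S X Y id \<longleftrightarrow> substruct S X Y"
  by (auto simp: embedding_def substruct_def)

lemma embedding_substruct:
  assumes "substruct S X Y" "embedding S Y Z h"
  shows "embedding S X Z h"
  using embedding_compose[of S X Y id Z h] assms by (simp add: embedding_id_iff_substruct)

lemma embedding_into_superstruct: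
  assumes "embedding S X Y h" "substruct S Y Z"
  shows "embedding S X Z h"
  using embedding_compose[of S X Y h Z id] assms by (simp add: embedding_id_iff_substruct)

lemma substruct_refl: "is_struct S X \<Longrightarrow> substruct S X X"
  by (simp add: substruct_def)

lemma substruct_trans: "substruct S X Y \<Longrightarrow> substruct S Y Z \<Longrightarrow> substruct S X Z"
  using embedding_substruct embedding_id_iff_substruct by blast

text \<open>Function values stay in the carrier, so \<open>h\<close> and \<open>k\<close> agree on
  them too. This turns a composite that fixes the carrier pointwise into \<open>id\<close>.\<close>

lemma embedding_cong:
  assumes "embedding S X Y h" "\<And>x. x \<in> carrier X \<Longrightarrow> h x = k x"
  shows "embedding S X Y k"
proof -
  have eq: "map k xs = map h xs" if "xs \<in> tuples (carrier X) n" for xs n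
    using that assms(2) by (auto simp: tuples_def)
  have "k (fint X f xs) = fint Y f (map k xs)"
    if "f \<in> funcs S" "xs \<in> tuples (carrier X) (farity S f)" for f xs
  proof -
    have "fint X f xs \<in> carrier X"
      using that embedding_structs(1)[OF assms(1)] by (simp add: is_struct_def)
    then show ?thesis
      using embedding_fint[OF assms(1) that] assms(2)
      by (metis eq[OF that(2)])
  qed
  moreover have "rint X r xs \<longleftrightarrow> rint Y r (map k xs)"
    if "r \<in> rels S" "xs \<in> tuples (carrier X) (rarity S r)" for r xs
    using embedding_rint[OF assms(1) that] by (metis eq[OF that(2)])
  moreover have "k ` carrier X \<subseteq> carrier Y" "inj_on k (carrier X)"
    using embedding_mem[OF assms(1)] embedding_inj[OF assms(1)] assms(2)
    by (auto simp: inj_on_def)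
  ultimately show ?thesis
    using embedding_structs[OF assms(1)] unfolding embedding_def by blast
qed

lemma embedding_inverse:
  assumes h: "embedding S X Y h" and surj: "h ` carrier X = carrier Y"
  shows "embedding S Y X (inv_into (carrier X) h)" (is "embedding S Y X ?k")
proof -
  have im: "?k ` carrier Y = carrier X"
    using inv_into_image_cancel[OF embedding_inj[OF h] subset_refl] surj by simp
  have hk: "map h (map ?k ys) = ys" if "ys \<in> tuples (carrier Y) n" for ys n
    using that unfolding surj[symmetric] tuples_def
    by (auto simp: f_inv_into_f subset_iff intro!: map_idI)
  have kt: "map ?k ys \<in> tuples (carrier X) n" if "ys \<in> tuples (carrier Y) n" for ys n
    using that im by (blast intro: map_tuples)
  have "?k (fint Y f ys) = fint X f (map ?k ys)"
    if f: "f \<in> funcs S" and ys: "ys \<in> tuples (carrier Y) (farity S f)" for f ys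
  proof -
    have "fint X f (map ?k ys) \<in> carrier X"
      using embedding_structs(1)[OF h] kt[OF ys] f by (simp add: is_struct_def)
    then have "?k (h (fint X f (map ?k ys))) = fint X f (map ?k ys)"
      using embedding_inj[OF h] by (simp add: inv_into_f_f)
    then show ?thesis
      using embedding_fint[OF h f kt[OF ys]] hk[OF ys] by simp
  qed
  moreover have "rint Y r ys \<longleftrightarrow> rint X r (map ?k ys)"
    if "r \<in> rels S" and "ys \<in> tuples (carrier Y) (rarity S r)" for r ys
    using embedding_rint[OF h that(1) kt[OF that(2)]] hk[OF that(2)] by simp
  ultimately show ?thesis
    using embedding_structs[OF h] im surj inj_on_inv_into[of "carrier Y" h "carrier X"]
    unfolding embedding_def by auto
qed

lemma isomorphic_sym: "isomorphic S X Y \<Longrightarrow> isomorphic S Y X"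
  unfolding isomorphic_def
  by (metis embedding_inj embedding_inverse inv_into_image_cancel subset_refl)

lemma isomorphic_trans:
  assumes "isomorphic S X Y" "isomorphic S Y Z"
  shows "isomorphic S X Z"
proof -
  obtain f g where "embedding S X Y f" "f ` carrier X = carrier Y"
    "embedding S Y Z g" "g ` carrier Y = carrier Z"
    using assms by (auto simp: isomorphic_def)
  then have "embedding S X Z (g \<circ> f)" "(g \<circ> f) ` carrier X = carrier Z"
    by (simp_all only: embedding_compose image_comp[symmetric])
  then show ?thesis unfolding isomorphic_def by blast
qed

section \<open>Isomorphic copies and inclusions\<close>

definition transport :: "('a \<Rightarrow> 'b) \<Rightarrow> ('a, 'f, 'r) struct \<Rightarrow> ('b, 'f, 'r) struct" where
  "transport j X =
     \<lparr>carrier = j ` carrier X,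
      fint = (\<lambda>f ys. j (fint X f (map (inv_into (carrier X) j) ys))),
      rint = (\<lambda>r ys. rint X r (map (inv_into (carrier X) j) ys))\<rparr>"

text \<open>Injectivity lets \<open>inv_into\<close> undo \<open>j\<close> on tuples over the
  carrier, so the interpretations pulled back along it are preserved by \<open>j\<close>.\<close>

lemma embedding_transport:
  assumes X: "is_struct S X" and j: "inj_on j (carrier X)"
  shows "embedding S X (transport j X) j"
proof -
  have "map (inv_into (carrier X) j) (map j xs) = xs" if "xs \<in> tuples (carrier X) n" for xs n
    using that j by (auto simp: tuples_def subset_iff intro!: map_idI)
  moreover have "map (inv_into (carrier X) j) ys \<in> tuples (carrier X) n"
    if "ys \<in> tuples (j ` carrier X) n" for ys n
    by (rule map_tuples[OF _ that]) (use j in auto)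
  ultimately show ?thesis
    using X j unfolding embedding_def is_struct_def transport_def by simp
qed

text \<open>Uncountability of the universe leaves room for the elements of \<open>X\<close> outside the range of \<open>f\<close>.\<close>

lemma embedding_to_inclusion:
  fixes A :: "('a, 'f, 'r) struct"
  assumes unc: "uncountable (UNIV :: 'a set)" and f: "embedding S A X f"
    and X: "countable (carrier X)"
  obtains W :: "('a, 'f, 'r) struct" and j where
    "embedding S X W j" "j ` carrier X = carrier W" "substruct S A W"
    "\<And>a. a \<in> carrier A \<Longrightarrow> j (f a) = a"
proof -
  let ?R = "f ` carrier A"
  have inj: "inj_on f (carrier A)" using f by (rule embedding_inj)
  have "?R \<subseteq> carrier X" using f by (simp add: embedding_def)
  then have "countable (carrier A)"
    using X countable_image_inj_on[OF _ inj] countable_subset by blast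
  then have "infinite (- carrier A)"
    using unc by (metis Compl_eq_Diff_UNIV countable_finite uncountable_minus_countable)
  then obtain u :: "nat \<Rightarrow> 'a" where u: "inj u" "range u \<subseteq> - carrier A"
    using infinite_countable_subset by blast
  \<comment> \<open>On the range of \<open>f\<close> the map undoes \<open>f\<close>; the other
    elements of \<open>X\<close> go injectively to points outside \<open>A\<close>. The image of
    \<open>X\<close> then literally contains \<open>A\<close>.\<close>
  define j where
    "j x = (if x \<in> ?R then inv_into (carrier A) f x else u (to_nat_on (carrier X) x))" for x
  have jf: "j (f a) = a" if "a \<in> carrier A" for a
    using that inj by (simp add: j_def)
  have injj: "inj_on j (carrier X)"
  proof (rule inj_onI)
    fix x y assume xy: "x \<in> carrier X" "y \<in> carrier X" "j x = j y"
    \<comment> \<open>The two branches of \<open>j\<close> have disjoint images, so injectivity can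
      be checked on each branch separately.\<close>
    have in_A: "j z \<in> carrier A \<longleftrightarrow> z \<in> ?R" for z
      using u(2) jf by (auto simp: j_def)
    show "x = y"
    proof (cases "x \<in> ?R")
      case True
      then have "y \<in> ?R" using xy(3) in_A by metis
      with True xy(3) jf show ?thesis by auto
    next
      case False
      then have "y \<notin> ?R" using xy(3) in_A by metis
      with False xy u(1) X show ?thesis
        by (simp add: j_def inj_eq to_nat_on_inj)
    qed
  qed
  have XW: "embedding S X (transport j X) j"
    using embedding_structs(2)[OF f] injj by (rule embedding_transport)
  have "embedding S A (transport j X) id"
    using embedding_compose[OF f XW] by (rule embedding_cong) (simp add: jf)
  then show thesis
    using that[of "transport j X" j] XW jf
    by (simp add: embedding_id_iff_substruct) (simp add: transport_def)
qed

section \<open>Finitely generated structures\<close>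

lemma generated_subset:
  assumes "is_struct S X" "B \<subseteq> carrier X"
  shows "generated S X B \<subseteq> carrier X"
proof
  fix x assume "x \<in> generated S X B"
  then show "x \<in> carrier X"
    using assms by induction (auto simp: is_struct_def tuples_def subset_iff)
qed

lemma generated_mono: "B \<subseteq> C \<Longrightarrow> generated S X B \<subseteq> generated S X C"
proof
  fix x assume "x \<in> generated S X B" "B \<subseteq> C"
  then show "x \<in> generated S X C" by induction (auto intro: generated.intros)
qed

text \<open>Generation reads only \<open>fint\<close>, so it may be computed in \<open>G\<close> for
  a substructure that is \<open>G\<close> with a smaller carrier.\<close>

lemma generated_carrier_update: "generated S (X\<lparr>carrier := C\<rparr>) B = generated S X B"
proof (rule set_eqI, rule iffI)
  fix x assume "x \<in> generated S (X\<lparr>carrier := C\<rparr>) B"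
  then show "x \<in> generated S X B" by induction (auto intro: generated.intros)
next
  fix x assume "x \<in> generated S X B"
  then show "x \<in> generated S (X\<lparr>carrier := C\<rparr>) B"
    by induction (auto intro: generated.base generated.app[where X = "X\<lparr>carrier := C\<rparr>", simplified])
qed

lemma embedding_generated:
  assumes h: "embedding S X Y h" and B: "B \<subseteq> carrier X"
  shows "h ` generated S X B = generated S Y (h ` B)"
proof
  show "h ` generated S X B \<subseteq> generated S Y (h ` B)"
  proof (rule image_subsetI)
    fix x assume "x \<in> generated S X B"
    then show "h x \<in> generated S Y (h ` B)"
    proof induction
      case (app f xs)
      have "xs \<in> tuples (carrier X) (farity S f)"
        using app generated_subset[OF embedding_structs(1)[OF h] B] by (auto simp: tuples_def)
      with app show ?case
        by (auto simp: embedding_fint[OF h] intro!: generated.app)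
    qed (auto intro: generated.base)
  qed
next
  show "generated S Y (h ` B) \<subseteq> h ` generated S X B"
  proof
    fix y assume "y \<in> generated S Y (h ` B)"
    then show "y \<in> h ` generated S X B"
    proof induction
      case (app f ys)
      then have "\<forall>y\<in>set ys. \<exists>x. x \<in> generated S X B \<and> h x = y" by auto
      \<comment> \<open>Preimages chosen entry by entry exhibit \<open>ys\<close> as the image of a
        tuple over \<open>X\<close>, where the function symbol can be applied.\<close>
      then obtain k where k: "\<And>y. y \<in> set ys \<Longrightarrow> k y \<in> generated S X B \<and> h (k y) = y" by metis
      have "map h (map k ys) = ys" using k by (auto intro!: map_idI)
      moreover have "map k ys \<in> tuples (carrier X) (farity S f)"
        using k app.hyps generated_subset[OF embedding_structs(1)[OF h] B] by (auto simp: tuples_def)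
      ultimately have "fint Y f ys = h (fint X f (map k ys))"
        using embedding_fint[OF h app.hyps(1)] by metis
      moreover have "fint X f (map k ys) \<in> generated S X B"
        by (rule generated.app) (use app.hyps k in auto)
      ultimately show ?case by blast
    qed (auto intro: generated.base)
  qed
qed

text \<open>Reduces an embedding of a finitely generated structure to its values on a finite list of
  generators, which is why Eve has only countably many cases to exclude.\<close>

lemma embeddings_eq_on_generated:
  assumes h: "embedding S X Y h" and k: "embedding S X Y k" and B: "B \<subseteq> carrier X"
    and eq: "\<And>b. b \<in> B \<Longrightarrow> h b = k b" and x: "x \<in> generated S X B"
  shows "h x = k x"
  using x
proof induction
  case (app f xs)
  have "xs \<in> tuples (carrier X) (farity S f)"
    using app generated_subset[OF embedding_structs(1)[OF h] B] by (auto simp: tuples_def)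
  moreover have "map h xs = map k xs" using app by simp
  ultimately show ?case
    by (metis app.hyps(1) embedding_fint[OF h] embedding_fint[OF k])
qed (rule eq)

section \<open>Generated substructures of G\<close>

lemma substruct_generated:
  assumes G: "is_struct S G" and B: "B \<subseteq> carrier G"
  shows "substruct S (G\<lparr>carrier := generated S G B\<rparr>) G"
proof -
  have "is_struct S (G\<lparr>carrier := generated S G B\<rparr>)"
    by (auto simp: is_struct_def tuples_def intro: generated.app)
  then show ?thesis
    using G generated_subset[OF G B] by (simp add: substruct_def)
qed

lemma generated_in_Age:
  assumes "is_struct S G" "finite B" "B \<subseteq> carrier G"
  shows "G\<lparr>carrier := generated S G B\<rparr> \<in> Age S G"
proof -
  have "substruct S (G\<lparr>carrier := generated S G B\<rparr>) G"
    using assms by (simp add: substruct_generated)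
  moreover have "B \<subseteq> generated S G B" by (auto intro: generated.base)
  ultimately show ?thesis
    using assms(2) embedding_id_iff_substruct[of S "G\<lparr>carrier := generated S G B\<rparr>" G]
    unfolding Age_def embeds_def finitely_generated_def
    by (auto simp: generated_carrier_update substruct_def)
qed

lemma embedding_into_substruct:
  assumes "embedding S X G h" "substruct S V G" "h ` carrier X \<subseteq> carrier V"
  shows "embedding S X V h"
  using assms map_tuples[OF assms(3)] unfolding embedding_def substruct_def by simp

lemma finitely_generated_image:
  assumes "finitely_generated S X" "embedding S X G h"
  obtains B where "finite B" "B \<subseteq> carrier G" "h ` carrier X = generated S G B"
proof -
  obtain C where C: "finite C" "C \<subseteq> carrier X" "generated S X C = carrier X"
    using assms(1) by (auto simp: finitely_generated_def)
  show thesis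
    using that[of "h ` C"] C embedding_generated[OF assms(2) C(2)] embedding_mem[OF assms(2)]
    by auto
qed

text \<open>The union of finite generating sets of both images generates the required substructure
  of \<open>G\<close>. The maps \<open>h\<close> and \<open>k\<close> are kept, so equations between
  them survive the passage from \<open>G\<close> to \<open>V\<close>.\<close>

lemma joint_embedding_in_Age:
  assumes X: "finitely_generated S X" "embedding S X G h"
    and Y: "finitely_generated S Y" "embedding S Y G k"
  obtains V where "V \<in> Age S G" "embedding S X V h" "embedding S Y V k"
proof -
  obtain B where B: "finite B" "B \<subseteq> carrier G" "h ` carrier X = generated S G B"
    using X by (rule finitely_generated_image)
  obtain C where C: "finite C" "C \<subseteq> carrier G" "k ` carrier Y = generated S G C"
    using Y by (rule finitely_generated_image)
  let ?V = "G\<lparr>carrier := generated S G (B \<union> C)\<rparr>"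
  have G: "is_struct S G" using X(2) by (rule embedding_structs)
  have V: "substruct S ?V G" using G B C by (simp add: substruct_generated)
  show thesis
  proof
    show "?V \<in> Age S G" using G B C by (simp add: generated_in_Age)
    show "embedding S X ?V h"
      using X(2) V by (rule embedding_into_substruct) (simp add: B(3) generated_mono)
    show "embedding S Y ?V k"
      using Y(2) V by (rule embedding_into_substruct) (simp add: C(3) generated_mono)
  qed
qed

lemma countable_if_embeds: "embeds S X G \<Longrightarrow> countable (carrier G) \<Longrightarrow> countable (carrier X)"
  unfolding embeds_def embedding_def using countable_image_inj_on countable_subset by metis

text \<open>Every member of \<open>F\<close> is isomorphic to a substructure of \<open>G\<close>
  generated by a finite set, and a countable set has only countably many finite subsets.\<close>

lemma countable_iso_types_if_subset_Age:
  assumes G: "countable (carrier G)" and F: "F \<subseteq> Age S G"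
  shows "countable (iso_types S F)"
proof -
  \<comment> \<open>Some of these classes may be empty, since a generated substructure need not be
    isomorphic to a member of \<open>F\<close>; a covering is enough.\<close>
  let ?c = "\<lambda>B. {Y \<in> F. isomorphic S Y (G\<lparr>carrier := generated S G B\<rparr>)}"
  have "iso_types S F \<subseteq> ?c ` {B. finite B \<and> B \<subseteq> carrier G}"
  proof
    fix c assume "c \<in> iso_types S F"
    then obtain X where X: "X \<in> F" and c: "c = {Y \<in> F. isomorphic S X Y}"
      by (auto simp: iso_types_def quotient_def)
    from X F obtain h where fg: "finitely_generated S X" and h: "embedding S X G h"
      by (auto simp: Age_def embeds_def)
    then obtain B where B: "finite B" "B \<subseteq> carrier G" "h ` carrier X = generated S G B"
      by (rule finitely_generated_image)
    let ?V = "G\<lparr>carrier := generated S G B\<rparr>"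
    have "substruct S ?V G"
      using embedding_structs(2)[OF h] B(2) by (rule substruct_generated)
    with h B(3) have "embedding S X ?V h" by (simp add: embedding_into_substruct)
    with B(3) have "isomorphic S X ?V" by (auto simp: isomorphic_def)
    then have "c = ?c B"
      unfolding c using isomorphic_sym isomorphic_trans by blast
    with B show "c \<in> ?c ` {B. finite B \<and> B \<subseteq> carrier G}" by blast
  qed
  then show ?thesis
    by (rule countable_subset) (intro countable_image countable_Collect_finite_subset G)
qed

section \<open>The game\<close>

lemma play_mono:
  assumes "BM_play S F A" "m \<le> n"
  shows "substruct S (A m) (A n)"
  using assms(2)
proof (induction rule: dec_induct)
  case base
  show ?case using assms(1) by (auto simp: BM_play_def substruct_def)
next
  case (step n)
  then show ?case using assms(1) substruct_trans unfolding BM_play_def by blast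
qed

text \<open>Any two members of the chain agree on common tuples. That the union is a structure is a
  premise, supplied later by an embedding of the union into \<open>G\<close>.\<close>

lemma play_substruct_union:
  assumes play: "BM_play S F A" and U: "is_struct S (chain_union A)"
  shows "substruct S (A n) (chain_union A)"
proof -
  have "fint (A n) f xs = fint (chain_union A) f xs"
    if f: "f \<in> funcs S" and xs: "xs \<in> tuples (carrier (A n)) (farity S f)" for f xs
  proof -
    \<comment> \<open>The stage at which the union evaluates \<open>xs\<close> is at most
      \<open>n\<close>, so \<open>A n\<close> extends it.\<close>
    let ?m = "LEAST m. set xs \<subseteq> carrier (A m)"
    have sub: "set xs \<subseteq> carrier (A n)" using xs by (simp add: tuples_def)
    then have "?m \<le> n" by (rule Least_le)
    moreover have "set xs \<subseteq> carrier (A ?m)" using sub by (rule LeastI)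
    ultimately have "fint (A ?m) f xs = fint (A n) f xs"
      using play_mono[OF play] f xs by (simp add: substruct_def tuples_def)
    then show ?thesis by (simp add: chain_union_def)
  qed
  moreover have "rint (A n) r xs \<longleftrightarrow> rint (chain_union A) r xs"
    if r: "r \<in> rels S" and xs: "xs \<in> tuples (carrier (A n)) (rarity S r)" for r xs
  proof -
    have "rint (A m) r xs \<longleftrightarrow> rint (A n) r xs" if "set xs \<subseteq> carrier (A m)" for m
    proof -
      \<comment> \<open>The witnessing stage \<open>m\<close> may lie before or after
        \<open>n\<close>; both are compared with a common later stage.\<close>
      have "substruct S (A m) (A (max m n))" "substruct S (A n) (A (max m n))"
        using play_mono[OF play] by auto
      with that r xs show ?thesis by (simp add: substruct_def tuples_def)
    qed
    moreover have "set xs \<subseteq> carrier (A n)" using xs by (simp add: tuples_def)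
    ultimately have "rint (A n) r xs \<longleftrightarrow> (\<exists>m. set xs \<subseteq> carrier (A m) \<and> rint (A m) r xs)"
      by blast
    then show ?thesis by (simp add: chain_union_def)
  qed
  moreover have "is_struct S (A n)" using play by (auto simp: BM_play_def substruct_def)
  ultimately show ?thesis
    using U unfolding substruct_def by (auto simp: chain_union_def)
qed

text \<open>
  Eve opens with \<open>Z\<close> and at her \<open>n\<close>-th later move excludes the \<open>n\<close>-th element of the countable
  set \<open>T\<close> of possible images of \<open>bs\<close> under an isomorphism to \<open>G\<close>.
\<close>

lemma eve_wins_by_exclusion:
  assumes F: "\<And>X. X \<in> F \<Longrightarrow> is_struct S X"
    and Z: "Z \<in> F"
    and T: "countable T" "\<And>h. embedding S Z G h \<Longrightarrow> map h bs \<in> T"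
    and excl: "\<And>A t. A \<in> F \<Longrightarrow> substruct S Z A \<Longrightarrow>
      \<exists>W\<in>F. substruct S A W \<and> \<not> (\<exists>h. embedding S W G h \<and> map h bs = t)"
  shows "\<exists>\<sigma>. eve_winning_strategy S F G \<sigma>"
proof -
  \<comment> \<open>The strategy must be legal at every position, also at those that do not start
    with \<open>Z\<close>. The guard \<open>substruct S Z A\<close> makes \<open>A\<close> itself an
    acceptable answer there.\<close>
  define good where "good A t W \<longleftrightarrow> W \<in> F \<and> substruct S A W \<and>
    (substruct S Z A \<longrightarrow> \<not> (\<exists>h. embedding S W G h \<and> map h bs = t))" for A t W
  define resp where "resp A t = (SOME W. good A t W)" for A t
  \<comment> \<open>At a position of length \<open>2 * n + 2\<close> the index is \<open>n\<close>,
    so the enumeration of \<open>T\<close> starts with Eve's second move.\<close>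
  define \<sigma> where "\<sigma> s = (if s = [] then Z
    else resp (last s) (from_nat_into T (length s div 2 - 1)))" for s
  have good: "good A t (resp A t)" if "A \<in> F" for A t
  proof -
    have "\<exists>W. good A t W"
      using excl[OF that, of t] that substruct_refl[OF F[OF that]] unfolding good_def by blast
    then show ?thesis unfolding resp_def by (rule someI_ex)
  qed
  have "position S F (s @ [\<sigma> s])" if "position S F s" for s
  proof (cases "s = []")
    case True
    then show ?thesis using Z by (simp add: \<sigma>_def position_def)
  next
    case False
    then have "last s \<in> F" using that by (auto simp: position_def)
    then have "\<sigma> s \<in> F" "substruct S (last s) (\<sigma> s)"
      using good False by (simp_all add: \<sigma>_def good_def)
    then show ?thesis
      using that False by (simp add: position_def successively_append_iff)
  qed
  then have "eve_strategy S F \<sigma>" by (simp add: eve_strategy_def)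
  moreover have "\<not> odd_wins S G A" if play: "BM_play S F A" and fol: "eve_follows \<sigma> A" for A
  proof
    assume "odd_wins S G A"
    then obtain h where h: "embedding S (chain_union A) G h"
      by (auto simp: odd_wins_def isomorphic_def)
    \<comment> \<open>The same \<open>h\<close> embeds every stage, so the tuple
      \<open>map h bs\<close> is fixed throughout the play and was excluded at one of Eve's
      moves.\<close>
    have hA: "embedding S (A n) G h" for n
      using play_substruct_union[OF play embedding_structs(1)[OF h]] h
      by (rule embedding_substruct)
    have A0: "A 0 = Z" using fol by (auto simp: eve_follows_def \<sigma>_def)
    then have "map h bs \<in> T" using hA[of 0] T(2) by simp
    then obtain n where n: "from_nat_into T n = map h bs"
      using T(1) from_nat_into_surj by metis
    have "A (2 * n + 2) = \<sigma> (map A [0..<2 * n + 2])"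
      using fol unfolding eve_follows_def by simp
    also have "\<dots> = resp (A (2 * n + 1)) (map h bs)"
      by (simp add: \<sigma>_def n)
    finally have "good (A (2 * n + 1)) (map h bs) (A (2 * n + 2))"
      using good play by (simp add: BM_play_def)
    moreover have "substruct S Z (A (2 * n + 1))"
      using play_mono[OF play] A0 by fastforce
    ultimately show False using hA unfolding good_def by blast
  qed
  ultimately show ?thesis unfolding eve_winning_strategy_def by blast
qed

section \<open>Joint embedding and weak amalgamation\<close>

lemma JEP_if_cofinal:
  assumes "cofinal_in S F (Age S G)"
  shows "JEP S F"
  unfolding JEP_def
proof (intro ballI)
  fix X Y assume "X \<in> F" "Y \<in> F"
  then have "X \<in> Age S G" "Y \<in> Age S G"
    using assms by (auto simp: cofinal_in_def)
  then obtain h k where "finitely_generated S X" "embedding S X G h"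
    "finitely_generated S Y" "embedding S Y G k"
    unfolding Age_def embeds_def by blast
  then obtain V where V: "V \<in> Age S G" "embedding S X V h" "embedding S Y V k"
    by (rule joint_embedding_in_Age)
  then obtain Z where "Z \<in> F" "substruct S V Z"
    using assms by (auto simp: cofinal_in_def)
  with V show "\<exists>Z\<in>F. embeds S X Z \<and> embeds S Y Z"
    unfolding embeds_def by (blast intro: embedding_into_superstruct)
qed

lemma WAP_if_no_eve_winning_strategy:
  fixes G :: "('a, 'f, 'r) struct"
  assumes unc: "uncountable (UNIV :: 'a set)"
    and G: "countable (carrier G)"
    and cof: "cofinal_in S F (Age S G)"
    and iso: "iso_closed S F"
    and no_win: "\<not> (\<exists>\<sigma>. eve_winning_strategy S F G \<sigma>)"
  shows "WAP S F"
proof (rule ccontr)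
  assume notWAP: "\<not> WAP S F"
  \<comment> \<open>Names the conclusion of the WAP, so that its failure yields one \<open>Z\<close>
    with a bad pair above every extension of \<open>Z\<close> in \<open>F\<close>.\<close>
  define amalg where "amalg Z X Y f g \<longleftrightarrow>
      (\<exists>V\<in>F. \<exists>f' g'. embedding S X V f' \<and> embedding S Y V g' \<and>
        (\<forall>z\<in>carrier Z. f' (f z) = g' (g z)))" for Z X Y :: "('a, 'f, 'r) struct" and f g
  obtain Z where Z: "Z \<in> F" and bad: "\<And>Z'. Z' \<in> F \<Longrightarrow> substruct S Z Z' \<Longrightarrow>
      \<exists>X\<in>F. \<exists>Y\<in>F. \<exists>f g. embedding S Z' X f \<and> embedding S Z' Y g \<and> \<not> amalg Z X Y f g"
    using notWAP unfolding WAP_def amalg_def[symmetric] by blast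
  have fg: "finitely_generated S X" and emb: "embeds S X G" if "X \<in> F" for X
    using that cof by (auto simp: cofinal_in_def Age_def)
  \<comment> \<open>Generators are listed so that the values of an embedding on them form one
    element of the countable set \<open>lists (carrier G)\<close>.\<close>
  obtain bs where bs: "set bs \<subseteq> carrier Z" "generated S Z (set bs) = carrier Z"
    using fg[OF Z] unfolding finitely_generated_def by (metis finite_list)
  have "\<exists>W\<in>F. substruct S A W \<and> \<not> (\<exists>h. embedding S W G h \<and> map h bs = t)"
    if A: "A \<in> F" "substruct S Z A" for A t
  proof -
    have bsA: "set bs \<subseteq> carrier A" using bs(1) A(2) by (auto simp: substruct_def)
    \<comment> \<open>The failure of the WAP provides an embedding \<open>f\<close>, but Eve must
      play a superstructure of \<open>A\<close>. A copy \<open>W\<close> of \<open>X\<close> serves: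
      as \<open>j\<close> undoes \<open>f\<close>, an embedding \<open>h\<close> of \<open>W\<close>
      gives the embedding \<open>h \<circ> j\<close> of \<open>X\<close> with the same values on
      \<open>bs\<close>.\<close>
    have copy: "\<exists>W\<in>F. substruct S A W \<and> \<not> (\<exists>h. embedding S W G h \<and> map h bs = t)"
      if X: "X \<in> F" "embedding S A X f"
        and no: "\<And>h. embedding S X G h \<Longrightarrow> map (h \<circ> f) bs \<noteq> t" for X f
    proof -
      obtain W j where W: "embedding S X W j" "j ` carrier X = carrier W" "substruct S A W"
        "\<And>a. a \<in> carrier A \<Longrightarrow> j (f a) = a"
        using unc X(2) countable_if_embeds[OF emb[OF X(1)] G] by (rule embedding_to_inclusion) blast
      have "W \<in> F" using iso X(1) W(1,2) unfolding iso_closed_def isomorphic_def by blast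
      moreover have "map h bs \<noteq> t" if "embedding S W G h" for h
      proof -
        have "map (h \<circ> j \<circ> f) bs = map h bs" using W(4) bsA by auto
        then show ?thesis using no[OF embedding_compose[OF W(1) that]] by metis
      qed
      ultimately show ?thesis using W(3) by blast
    qed
    obtain X Y f g where X: "X \<in> F" "embedding S A X f" and Y: "Y \<in> F" "embedding S A Y g"
      and na: "\<not> amalg Z X Y f g"
      using bad[OF A] by blast
    show ?thesis
    proof (rule ccontr)
      \<comment> \<open>If neither copy excludes \<open>t\<close>, then both \<open>X\<close> and
        \<open>Y\<close> embed into \<open>G\<close> with \<open>bs\<close> sent to
        \<open>t\<close>. These embeddings agree on all of \<open>Z\<close>, as \<open>bs\<close>
        generates it.\<close>
      assume "\<not> ?thesis"
      then obtain h k where h: "embedding S X G h" "map (h \<circ> f) bs = t"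
        and k: "embedding S Y G k" "map (k \<circ> g) bs = t"
        using copy[OF X] copy[OF Y] by blast
      have eq: "h (f z) = k (g z)" if "z \<in> carrier Z" for z
      proof -
        have "(h \<circ> f) z = (k \<circ> g) z"
        proof (rule embeddings_eq_on_generated[where B = "set bs"
            and h = "h \<circ> f" and k = "k \<circ> g" and X = Z and Y = G and S = S])
          show "embedding S Z G (h \<circ> f)" "embedding S Z G (k \<circ> g)"
            using A(2) X(2) Y(2) h(1) k(1) by (blast intro: embedding_substruct embedding_compose)+
          show "(h \<circ> f) b = (k \<circ> g) b" if "b \<in> set bs" for b
            using h(2) k(2) that by (metis map_eq_conv)
        qed (use bs that in auto)
        then show ?thesis by simp
      qed
      \<comment> \<open>The maps \<open>h\<close> and \<open>k\<close> themselves amalgamate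
        \<open>X\<close> and \<open>Y\<close> over \<open>Z\<close> inside \<open>G\<close>;
        cofinality then enlarges \<open>V\<close> to a member of \<open>F\<close>.\<close>
      obtain V where V: "V \<in> Age S G" "embedding S X V h" "embedding S Y V k"
        using fg[OF X(1)] h(1) fg[OF Y(1)] k(1) by (rule joint_embedding_in_Age)
      then obtain V' where "V' \<in> F" "substruct S V V'"
        using cof by (auto simp: cofinal_in_def)
      with V have "embedding S X V' h" "embedding S Y V' k"
        by (auto intro: embedding_into_superstruct)
      with \<open>V' \<in> F\<close> eq na show False unfolding amalg_def by blast
    qed
  qed
  moreover have "map h bs \<in> lists (carrier G)" if "embedding S Z G h" for h
    using embedding_mem[OF that] bs(1) by (auto simp: subset_iff)
  moreover have "is_struct S X" if "X \<in> F" for X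
    using fg[OF that] by (simp add: finitely_generated_def)
  ultimately show False
    using eve_wins_by_exclusion[of F S Z "lists (carrier G)" G bs] Z G no_win by blast
qed

theorem corollary4p4:
  fixes S :: "('f, 'r) signature"
    and G :: "('a, 'f, 'r) struct"
    and F :: "('a, 'f, 'r) struct set"
  assumes "uncountable (UNIV :: 'a set)"
    and "countable_signature S"
    and "is_struct S G"
    and "countable (carrier G)"
    and "cofinal_in S F (Age S G)"
    and "iso_closed S F"
    and "\<not> (\<exists>\<sigma>. eve_winning_strategy S F G \<sigma>)"
  shows "weak_Fraisse_class S F"
proof -
  have "F \<subseteq> Age S G" using assms(5) by (simp add: cofinal_in_def)
  then show ?thesis
    unfolding weak_Fraisse_class_def
    using JEP_if_cofinal[OF assms(5)] WAP_if_no_eve_winning_strategy[OF assms(1,4-7)]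
      countable_iso_types_if_subset_Age[OF assms(4)]
    by simp
qed

end
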